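(* Let $p$ be a prime, $V_1=\mathbb{F}_p^k$, $n$ a positive integer, and $V=V_1^n$. Let $G_1\le GL(V_1)$ and $H\le S_n$, and suppose either (i) $G_1$ is transitive on $V_1\setminus\{0\}$ and $H$ is $p$-concealed, or (ii) $G_1$ is $p$-exceptional and $H$ has order coprime to $p$. Then the wreath product $G_1\wr H$, acting naturally on $V=V_1^n$, is $p$-exceptional.
   Context: $G\le GL(V)$ is $p$-exceptional if $p$ divides $|G|$ and every orbit of $G$ on $V$ has size coprime to $p$. $H\le S_n$ is $p$-concealed if $p$ divides $|H|$ and every orbit of $H$ on the power set of $\{1,\dots,n\}$ has size coprime to $p$. *)

theory Defs
  imports "HOL-Analysis.Analysis"
begin

text \<open>A group of permutations of a (finite) type, given as a set of maps closed
  under composition and inversion (a subgroup of Sym(UNIV)).\<close>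
definition perm_group :: "('a \<Rightarrow> 'a) set \<Rightarrow> bool" where
  "perm_group G \<longleftrightarrow> G \<noteq> {} \<and> (\<forall>g\<in>G. bij g) \<and>
     (\<forall>g\<in>G. \<forall>h\<in>G. g \<circ> h \<in> G) \<and> (\<forall>g\<in>G. inv g \<in> G)"

text \<open>GL(V): invertible linear maps of an F-vector space V with scalar
  multiplication smul.\<close>
definition GL :: "('f::field \<Rightarrow> 'v::ab_group_add \<Rightarrow> 'v) \<Rightarrow> ('v \<Rightarrow> 'v) set" where
  "GL smul = {g. Vector_Spaces.linear smul smul g \<and> bij g}"

text \<open>G is a subgroup of GL(V).\<close>
definition linear_group :: "('f::field \<Rightarrow> 'v::ab_group_add \<Rightarrow> 'v) \<Rightarrow> ('v \<Rightarrow> 'v) set \<Rightarrow> bool" where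
  "linear_group smul G \<longleftrightarrow> perm_group G \<and> G \<subseteq> GL smul"

text \<open>Scalar multiplication on V1^n = ('f^'k)^'n (blockwise).\<close>
definition block_scale :: "'f::field \<Rightarrow> ('f ^ 'k) ^ 'n \<Rightarrow> ('f ^ 'k) ^ 'n" where
  "block_scale c v = (\<chi> j. c *s (v $ j))"

definition orbit :: "('a \<Rightarrow> 'a) set \<Rightarrow> 'a \<Rightarrow> 'a set" where
  "orbit G x = (\<lambda>g. g x) ` G"

text \<open>p-exceptional linear groups.\<close>
definition p_exceptional :: "('f::field \<Rightarrow> 'v::ab_group_add \<Rightarrow> 'v) \<Rightarrow> nat \<Rightarrow> ('v \<Rightarrow> 'v) set \<Rightarrow> bool" where
  "p_exceptional smul p G \<longleftrightarrow> linear_group smul G \<and> p dvd card G \<and>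
     (\<forall>v. coprime (card (orbit G v)) p)"

text \<open>p-concealed permutation groups: orbits on the power set of the point set.\<close>
definition p_concealed :: "nat \<Rightarrow> ('n \<Rightarrow> 'n) set \<Rightarrow> bool" where
  "p_concealed p H \<longleftrightarrow> perm_group H \<and> p dvd card H \<and>
     (\<forall>A :: 'n set. coprime (card ((\<lambda>h. h ` A) ` H)) p)"

text \<open>Transitivity on the nonzero vectors.\<close>
definition transitive_nonzero :: "('f::field ^ 'm \<Rightarrow> 'f ^ 'm) set \<Rightarrow> bool" where
  "transitive_nonzero G \<longleftrightarrow> (\<forall>v w. v \<noteq> 0 \<longrightarrow> w \<noteq> 0 \<longrightarrow> (\<exists>g\<in>G. g v = w))"

text \<open>The wreath product G1 wr H acting naturally on V1^n: the element
  (g_1,...,g_n; h) sends (v_i)_i to w with w_{h(i)} = g_i(v_i).\<close>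
definition wreath :: "('v \<Rightarrow> 'v) set \<Rightarrow> ('n::finite \<Rightarrow> 'n) set \<Rightarrow> ('v ^ 'n \<Rightarrow> 'v ^ 'n) set" where
  "wreath G1 H = {(\<lambda>v. \<chi> j. g (inv h j) (v $ (inv h j))) | g h. (\<forall>i. g i \<in> G1) \<and> h \<in> H}"

end

theory Submission
  imports Defs
begin

text \<open>
  Let W = G1 wr H act on V = V1^n.  An element (g;h) of W moves coordinate i of a
  vector to coordinate h(i) and applies g_i there, so w lies in the W-orbit of v
  iff for some h in H every w_{h(i)} lies in the G1-orbit of v_i.  Recording for
  each coordinate the G1-orbit of that coordinate (the orbit pattern of a vector)
  therefore maps the W-orbit of v onto the H-orbit of the pattern Q of v, and
  every fibre is a product of G1-orbits of total size prod_i |Q_i|.  Hence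
    |orbit_W(v)| = |H-orbit of Q| * prod_i |Q_i|.
  (i) If G1 is transitive on V1 - {0}, the pattern of v is determined by the
  support A of v, the H-orbit of Q is in bijection with the H-orbit of A (coprime
  to p since H is p-concealed), and each |Q_i| is 1 or p^k - 1.
  (ii) If G1 is p-exceptional, each |Q_i| is coprime to p, and the H-orbit of Q has
  size dividing |H|, which is coprime to p.
  Finally |W| = |G1|^n |H|, so p divides |W| in both cases, and W is a linear
  group on V because its elements are blockwise linear bijections.
\<close>

subsection \<open>Counting and permutation groups\<close>

text \<open>Counting a finite set through a map all of whose fibres have the same size.\<close>
lemma card_by_fibres:
  assumes "finite X" and "\<And>y. y \<in> f ` X \<Longrightarrow> card {x\<in>X. f x = y} = c"
  shows "card X = card (f ` X) * c"
proof -
  have X: "X = (\<Union>y\<in>f ` X. {x\<in>X. f x = y})" by auto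
  have "card X = (\<Sum>y\<in>f ` X. card {x\<in>X. f x = y})"
    by (subst X, rule card_UN_disjoint) (use assms in auto)
  also have "\<dots> = (\<Sum>y\<in>f ` X. c)" using assms(2) by simp
  finally show ?thesis by simp
qed

lemma perm_group_bij: "perm_group G \<Longrightarrow> g \<in> G \<Longrightarrow> bij g"
  unfolding perm_group_def by auto

lemma perm_group_comp: "perm_group G \<Longrightarrow> g \<in> G \<Longrightarrow> h \<in> G \<Longrightarrow> g \<circ> h \<in> G"
  unfolding perm_group_def by auto

lemma perm_group_inv: "perm_group G \<Longrightarrow> g \<in> G \<Longrightarrow> inv g \<in> G"
  unfolding perm_group_def by auto

lemma perm_group_id: "perm_group G \<Longrightarrow> id \<in> G"
  unfolding perm_group_def by (metis all_not_in_conv bij_is_inj inv_o_cancel)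

lemma orbit_self: "perm_group G \<Longrightarrow> x \<in> orbit G x"
  unfolding orbit_def by (rule image_eqI[where x=id]) (auto simp: perm_group_id)

text \<open>The orbits of a permutation group partition the underlying set.\<close>
lemma orbit_eq_iff:
  assumes G: "perm_group G"
  shows "orbit G y = orbit G x \<longleftrightarrow> y \<in> orbit G x"
proof
  assume "y \<in> orbit G x"
  then obtain g where g: "g \<in> G" "y = g x" unfolding orbit_def by auto
  have x: "x = inv g y" using perm_group_bij[OF G g(1)] g(2) by (simp add: bij_is_inj)
  have "orbit G b \<subseteq> orbit G a" if "k \<in> G" "b = k a" for k a b
  proof
    fix z assume "z \<in> orbit G b"
    then obtain l where "l \<in> G" "z = l b" unfolding orbit_def by auto
    then have "z = (l \<circ> k) a" "l \<circ> k \<in> G" using that perm_group_comp[OF G] by auto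
    then show "z \<in> orbit G a" unfolding orbit_def by blast
  qed
  then show "orbit G y = orbit G x"
    using g x perm_group_inv[OF G g(1)] by blast
qed (use orbit_self[OF G] in blast)

text \<open>Orbit--stabiliser divisibility for an arbitrary action of a finite permutation
  group: the stabiliser's left cosets are the fibres of the orbit map.\<close>
lemma card_orbit_dvd_card:
  fixes G :: "('a \<Rightarrow> 'a) set" and act :: "('a \<Rightarrow> 'a) \<Rightarrow> 'b \<Rightarrow> 'b"
  assumes G: "perm_group G" and fin: "finite G"
    and act_comp: "\<And>g h y. g \<in> G \<Longrightarrow> h \<in> G \<Longrightarrow> act (g \<circ> h) y = act g (act h y)"
    and act_id: "\<And>y. act id y = y"
  shows "card ((\<lambda>g. act g x) ` G) dvd card G"
proof -
  let ?Stab = "{g\<in>G. act g x = x}"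
  have "card G = card ((\<lambda>g. act g x) ` G) * card ?Stab"
  proof (rule card_by_fibres[OF fin])
    fix y assume "y \<in> (\<lambda>g. act g x) ` G"
    then obtain g0 where g0: "g0 \<in> G" "y = act g0 x" by auto
    have g0_bij: "bij g0" and g0_inv: "inv g0 \<in> G"
      using g0(1) perm_group_bij[OF G] perm_group_inv[OF G] by auto
    have "bij_betw (\<lambda>s. g0 \<circ> s) ?Stab {g\<in>G. act g x = y}"
    proof (rule bij_betwI[where g="\<lambda>k. inv g0 \<circ> k"])
      show "(\<circ>) g0 \<in> ?Stab \<rightarrow> {g \<in> G. act g x = y}"
        using g0 act_comp perm_group_comp[OF G] by auto
      show "(\<circ>) (inv g0) \<in> {g \<in> G. act g x = y} \<rightarrow> ?Stab"
      proof
        fix k assume k: "k \<in> {g \<in> G. act g x = y}"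
        have "act (inv g0 \<circ> k) x = act (inv g0 \<circ> g0) x"
          using k g0 g0_inv act_comp by auto
        also have "\<dots> = x" using g0_bij by (simp add: bij_is_inj act_id)
        finally show "inv g0 \<circ> k \<in> ?Stab" using k g0_inv perm_group_comp[OF G] by auto
      qed
      show "inv g0 \<circ> (g0 \<circ> s) = s" for s
        using g0_bij by (metis bij_is_inj inv_o_cancel comp_assoc id_comp)
      show "g0 \<circ> (inv g0 \<circ> s) = s" for s
        using g0_bij by (metis bij_def surj_iff comp_assoc id_comp)
    qed
    then show "card {g\<in>G. act g x = y} = card ?Stab" by (simp add: bij_betw_same_card)
  qed
  then show ?thesis by simp
qed

text \<open>The number of vectors whose coordinates range over prescribed sets.\<close>
lemma card_vec_product:
  fixes S :: "'n::finite \<Rightarrow> 'v set"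
  shows "card {w :: 'v^'n. \<forall>j. w $ j \<in> S j} = (\<Prod>j\<in>UNIV. card (S j))"
proof -
  have "{w :: 'v^'n. \<forall>j. w $ j \<in> S j} = vec_lambda ` PiE UNIV S"
  proof (intro set_eqI iffI)
    fix w :: "'v^'n" assume "w \<in> {w. \<forall>j. w $ j \<in> S j}"
    then show "w \<in> vec_lambda ` PiE UNIV S"
      by (intro image_eqI[of _ _ "vec_nth w"]) (auto simp: PiE_UNIV_domain)
  qed (auto simp: PiE_UNIV_domain)
  moreover have "inj_on (vec_lambda :: ('n \<Rightarrow> 'v) \<Rightarrow> 'v^'n) (PiE UNIV S)"
    by (rule inj_onI) (simp add: vec_lambda_inject)
  ultimately show ?thesis by (simp add: card_image card_PiE)
qed

text \<open>Relabelling the coordinates of a function by a bijection.\<close>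
lemma bij_fun_eq_comp_inv:
  assumes "bij h" shows "(\<forall>i. P (h i) = Q i) \<longleftrightarrow> P = Q \<circ> inv h"
  using assms by (auto simp: fun_eq_iff bij_is_inj) (metis bij_is_surj surj_f_inv_f)

subsection \<open>Elements of the wreath product\<close>

text \<open>The element (g;h) of G1 wr H: coordinate i is sent to h(i) and transformed
  by g_i.\<close>
definition wreath_map :: "('n::finite \<Rightarrow> 'v \<Rightarrow> 'v) \<Rightarrow> ('n \<Rightarrow> 'n) \<Rightarrow> 'v^'n \<Rightarrow> 'v^'n" where
  "wreath_map g h = (\<lambda>v. \<chi> j. g (inv h j) (v $ inv h j))"

text \<open>G1 wr H is the set of all elements (g;h) with g_i in G1 and h in H.\<close>
lemma wreath_eq: "wreath G1 H = {wreath_map g h | g h. (\<forall>i. g i \<in> G1) \<and> h \<in> H}"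
  unfolding wreath_def wreath_map_def by simp

lemma wreath_map_nth: "wreath_map g h v $ j = g (inv h j) (v $ inv h j)"
  unfolding wreath_map_def by simp

text \<open>(g;h) places g_i(v_i) in coordinate h(i).\<close>
lemma wreath_map_nth_image: "bij h \<Longrightarrow> wreath_map g h v $ h i = g i (v $ i)"
  unfolding wreath_map_def by (simp add: bij_is_inj)

text \<open>Multiplication rule: (g2;h2)(g1;h1) = ((g2 o h1) g1; h2 h1).\<close>
lemma wreath_map_comp:
  assumes "bij h1" "bij h2"
  shows "wreath_map g2 h2 \<circ> wreath_map g1 h1 = wreath_map (\<lambda>i. g2 (h1 i) \<circ> g1 i) (h2 \<circ> h1)"
proof (rule ext, subst vec_eq_iff, rule allI)
  fix v j
  have b: "bij (h2 \<circ> h1)" using assms by (simp add: bij_comp)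
  then obtain i where j: "j = (h2 \<circ> h1) i" by (metis bij_pointE)
  show "(wreath_map g2 h2 \<circ> wreath_map g1 h1) v $ j
      = wreath_map (\<lambda>i. g2 (h1 i) \<circ> g1 i) (h2 \<circ> h1) v $ j"
    unfolding j wreath_map_nth_image[OF b] by (simp add: assms wreath_map_nth_image)
qed

lemma wreath_map_id: "wreath_map (\<lambda>_. id) id = id"
  unfolding wreath_map_def by (simp add: inv_id fun_eq_iff)

text \<open>The inverse of (g;h) is (g';h^-1) with g'_j the inverse of g at the
  coordinate that h sends to j.\<close>
lemma wreath_map_inverse:
  assumes h: "bij h" and g: "\<And>i. bij (g i)"
  defines "g' \<equiv> \<lambda>j. inv (g (inv h j))"
  shows "wreath_map g' (inv h) \<circ> wreath_map g h = id"
    and "wreath_map g h \<circ> wreath_map g' (inv h) = id"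
proof -
  have h_inv: "bij (inv h)" using h by (simp add: bij_imp_bij_inv)
  have left: "(\<lambda>i. g' (h i) \<circ> g i) = (\<lambda>_. id)" "inv h \<circ> h = id"
    unfolding g'_def using g h by (auto simp: fun_eq_iff bij_is_inj bij_inv_eq_iff)
  show "wreath_map g' (inv h) \<circ> wreath_map g h = id"
    unfolding wreath_map_comp[OF h h_inv] left wreath_map_id ..
  have right: "(\<lambda>i. g (inv h i) \<circ> g' i) = (\<lambda>_. id)" "h \<circ> inv h = id"
    unfolding g'_def using g h by (auto simp: fun_eq_iff bij_is_surj surj_f_inv_f)
  show "wreath_map g h \<circ> wreath_map g' (inv h) = id"
    unfolding wreath_map_comp[OF h_inv h] right wreath_map_id ..
qed

text \<open>As soon as V1 has two distinct points, an element of the wreath product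
  determines its parameters (g;h).\<close>
lemma wreath_map_inj:
  fixes h h' :: "'n::finite \<Rightarrow> 'n" and g g' :: "'n \<Rightarrow> 'v \<Rightarrow> 'v"
  assumes h: "bij h" "bij h'" and g: "\<And>i. inj (g i)" and ab: "a \<noteq> (b::'v)"
    and eq: "wreath_map g h = wreath_map g' h'"
  shows "g = g' \<and> h = h'"
proof -
  have "h i = h' i" for i
  proof (rule ccontr)
    assume ne: "h i \<noteq> h' i"
    then have other: "inv h' (h i) \<noteq> i" using h(2) by (metis bij_inv_eq_iff)
    define va where "va = ((\<chi> _. a) :: 'v^'n)"
    define vb where "vb = ((\<chi> m. if m = i then b else a) :: 'v^'n)"
    have "wreath_map g' h' va $ h i = wreath_map g' h' vb $ h i"
      using other unfolding wreath_map_nth va_def vb_def by simp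
    then have "g i a = g i b"
      unfolding eq[symmetric] wreath_map_nth_image[OF h(1)] va_def vb_def by simp
    then show False using g ab by (meson injD)
  qed
  then have hh: "h = h'" by blast
  have "g i u = g' i u" for i u
    using arg_cong[OF eq, of "\<lambda>f. f (\<chi> _. u) $ h i"]
    unfolding hh wreath_map_nth_image[OF h(2)] by simp
  with hh show ?thesis by blast
qed

text \<open>|G1 wr H| = |G1|^n |H|.\<close>
lemma card_wreath:
  fixes G1 :: "('v \<Rightarrow> 'v) set" and H :: "('n::finite \<Rightarrow> 'n) set"
  assumes G1: "perm_group G1" and H: "perm_group H" and two: "\<exists>a b::'v. a \<noteq> b"
  shows "card (wreath G1 H) = card G1 ^ CARD('n) * card H"
proof -
  let ?P = "{g :: 'n \<Rightarrow> _. \<forall>i. g i \<in> G1}"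
  have W: "wreath G1 H = (\<lambda>(g,h). wreath_map g h) ` (?P \<times> H)" unfolding wreath_eq by auto
  obtain a b :: 'v where ab: "a \<noteq> b" using two by blast
  have "inj_on (\<lambda>(g,h). wreath_map g h) (?P \<times> H)"
  proof (rule inj_onI)
    fix x y assume x: "x \<in> ?P \<times> H" and y: "y \<in> ?P \<times> H"
      and eq: "(\<lambda>(g,h). wreath_map g h) x = (\<lambda>(g,h). wreath_map g h) y"
    obtain g h g' h' where xy: "x = (g, h)" "y = (g', h')" by fastforce
    have "g = g' \<and> h = h'"
      using x y eq perm_group_bij[OF G1] perm_group_bij[OF H] unfolding xy
      by (intro wreath_map_inj[OF _ _ _ ab]) (auto simp: bij_is_inj)
    then show "x = y" unfolding xy by simp
  qed
  moreover have "?P = PiE UNIV (\<lambda>_. G1)" by (auto simp: PiE_UNIV_domain)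
  ultimately show ?thesis unfolding W by (simp add: card_image card_cartesian_product card_PiE)
qed

lemma wreath_map_mem: "(\<forall>i. g i \<in> G1) \<Longrightarrow> h \<in> H \<Longrightarrow> wreath_map g h \<in> wreath G1 H"
  unfolding wreath_eq by blast

text \<open>Every element of G1 wr H is a bijection with its inverse again in G1 wr H.\<close>
lemma wreath_map_bij_inv:
  assumes G1: "perm_group G1" and H: "perm_group H"
    and g: "\<forall>i. g i \<in> G1" and h: "h \<in> H"
  shows "bij (wreath_map g h)" and "inv (wreath_map g h) \<in> wreath G1 H"
proof -
  define g' where "g' = (\<lambda>j. inv (g (inv h j)))"
  have h_bij: "bij h" and g_bij: "\<And>i. bij (g i)"
    using g h perm_group_bij[OF G1] perm_group_bij[OF H] by auto
  note inverse = wreath_map_inverse[of h g, OF h_bij g_bij, folded g'_def]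
  show "bij (wreath_map g h)" using inverse by (intro o_bij) auto
  have "inv (wreath_map g h) = wreath_map g' (inv h)"
    using inverse by (intro inv_unique_comp) auto
  moreover have "wreath_map g' (inv h) \<in> wreath G1 H"
    unfolding g'_def using g h perm_group_inv[OF G1] perm_group_inv[OF H]
    by (intro wreath_map_mem) auto
  ultimately show "inv (wreath_map g h) \<in> wreath G1 H" by simp
qed

text \<open>G1 wr H is again a permutation group.\<close>
lemma perm_group_wreath:
  assumes G1: "perm_group G1" and H: "perm_group H"
  shows "perm_group (wreath G1 H)"
  unfolding perm_group_def
proof (intro conjI ballI)
  show "wreath G1 H \<noteq> {}"
    using wreath_map_mem[of "\<lambda>_. id"] perm_group_id[OF G1] perm_group_id[OF H] by blast
next
  fix f assume "f \<in> wreath G1 H"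
  then obtain g h where "f = wreath_map g h" "\<forall>i. g i \<in> G1" "h \<in> H"
    unfolding wreath_eq by blast
  then show "bij f" "inv f \<in> wreath G1 H" using wreath_map_bij_inv[OF G1 H] by auto
next
  fix f1 f2 assume "f1 \<in> wreath G1 H" "f2 \<in> wreath G1 H"
  then obtain g1 h1 g2 h2 where f: "f1 = wreath_map g1 h1" "\<forall>i. g1 i \<in> G1" "h1 \<in> H"
    "f2 = wreath_map g2 h2" "\<forall>i. g2 i \<in> G1" "h2 \<in> H" unfolding wreath_eq by blast
  have "f1 \<circ> f2 = wreath_map (\<lambda>i. g1 (h2 i) \<circ> g2 i) (h1 \<circ> h2)"
    using f wreath_map_comp[OF perm_group_bij[OF H f(6)] perm_group_bij[OF H f(3)]] by simp
  then show "f1 \<circ> f2 \<in> wreath G1 H"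
    using f perm_group_comp[OF G1] perm_group_comp[OF H] by (auto intro: wreath_map_mem)
qed

subsection \<open>Linearity\<close>

text \<open>V1^n with blockwise scalar multiplication is a vector space.\<close>
lemma vector_space_block_scale: "vector_space (block_scale :: 'f::field \<Rightarrow> ('f ^ 'k) ^ 'n \<Rightarrow> _)"
  unfolding vector_space_def block_scale_def
  by (simp add: vec_eq_iff vector_add_ldistrib vector_sadd_rdistrib vector_smult_assoc)

text \<open>A wreath element with linear components is linear on V1^n.\<close>
lemma wreath_map_linear:
  assumes "\<And>i. Vector_Spaces.linear (*s) (*s) (g i :: 'f::field^'k \<Rightarrow> _)"
  shows "Vector_Spaces.linear block_scale block_scale
    (wreath_map g h :: ('f^'k)^'n::finite \<Rightarrow> _)"
proof -
  have g: "g i (x + y) = g i x + g i y" "g i (c *s x) = c *s g i x" for i x y c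
    using assms[of i, unfolded Vector_Spaces.linear_iff] by auto
  show ?thesis unfolding Vector_Spaces.linear_iff
    by (simp add: vector_space_block_scale vec_eq_iff wreath_map_nth g block_scale_def)
qed

text \<open>For a linear group G1, G1 wr H is a linear group on V1^n.\<close>
lemma linear_group_wreath:
  fixes G1 :: "('f::field ^ 'k \<Rightarrow> 'f ^ 'k) set" and H :: "('n::finite \<Rightarrow> 'n) set"
  assumes G1: "linear_group (*s) G1" and H: "perm_group H"
  shows "linear_group (block_scale :: 'f \<Rightarrow> _) (wreath G1 H)"
proof -
  have pG1: "perm_group G1" and lin: "\<And>g. g \<in> G1 \<Longrightarrow> Vector_Spaces.linear (*s) (*s) g"
    using G1 unfolding linear_group_def GL_def by auto
  have "f \<in> GL block_scale" if fW: "f \<in> wreath G1 H" for f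
  proof -
    obtain g h where f: "f = wreath_map g h" "\<forall>i. g i \<in> G1" "h \<in> H"
      using fW unfolding wreath_eq by blast
    have "Vector_Spaces.linear block_scale block_scale f"
      unfolding f(1) by (rule wreath_map_linear) (use f(2) lin in blast)
    then show ?thesis
      using wreath_map_bij_inv(1)[OF pG1 H f(2,3)] f(1) unfolding GL_def by simp
  qed
  then show ?thesis
    unfolding linear_group_def using perm_group_wreath[OF pG1 H] by blast
qed

subsection \<open>Orbits of the wreath product\<close>

text \<open>w is in the orbit of v iff some h in H moves every coordinate v_i to a
  coordinate of w in the same G1-orbit.\<close>
lemma orbit_wreath_iff:
  fixes G1 :: "('v \<Rightarrow> 'v) set" and H :: "('n::finite \<Rightarrow> 'n) set"
  assumes G1: "perm_group G1" and H: "perm_group H"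
  shows "w \<in> orbit (wreath G1 H) v \<longleftrightarrow> (\<exists>h\<in>H. \<forall>i. w $ h i \<in> orbit G1 (v $ i))"
proof
  assume "w \<in> orbit (wreath G1 H) v"
  then obtain g h where gh: "\<forall>i. g i \<in> G1" "h \<in> H" "w = wreath_map g h v"
    unfolding orbit_def wreath_eq by blast
  have "w $ h i = g i (v $ i)" for i
    unfolding gh(3) by (rule wreath_map_nth_image[OF perm_group_bij[OF H gh(2)]])
  then show "\<exists>h\<in>H. \<forall>i. w $ h i \<in> orbit G1 (v $ i)"
    using gh(1,2) unfolding orbit_def by blast
next
  assume "\<exists>h\<in>H. \<forall>i. w $ h i \<in> orbit G1 (v $ i)"
  then obtain h where h: "h \<in> H" "\<forall>i. \<exists>x\<in>G1. w $ h i = x (v $ i)"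
    unfolding orbit_def by blast
  then obtain g where g: "\<forall>i. g i \<in> G1 \<and> w $ h i = g i (v $ i)" by metis
  have h_bij: "bij h" using perm_group_bij[OF H h(1)] .
  have "wreath_map g h v = w"
  proof (subst vec_eq_iff, rule allI)
    fix j obtain i where "j = h i" using h_bij by (metis bij_pointE)
    then show "wreath_map g h v $ j = w $ j" using wreath_map_nth_image[OF h_bij] g by simp
  qed
  moreover have "wreath_map g h \<in> wreath G1 H" using g h(1) by (intro wreath_map_mem) auto
  ultimately show "w \<in> orbit (wreath G1 H) v" unfolding orbit_def by blast
qed

text \<open>The orbit pattern of a vector: the G1-orbit of each of its coordinates.\<close>
definition orbit_pattern :: "('v \<Rightarrow> 'v) set \<Rightarrow> 'v^'n \<Rightarrow> 'n \<Rightarrow> 'v set" where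
  "orbit_pattern G w j = orbit G (w $ j)"

text \<open>Membership in a wreath orbit depends only on the orbit pattern, which must
  be a coordinate permutation (by an element of H) of the pattern of v.\<close>
lemma orbit_wreath_pattern_iff:
  fixes G1 :: "('v \<Rightarrow> 'v) set" and H :: "('n::finite \<Rightarrow> 'n) set"
  assumes G1: "perm_group G1" and H: "perm_group H"
  shows "w \<in> orbit (wreath G1 H) v \<longleftrightarrow>
    (\<exists>h\<in>H. orbit_pattern G1 w = orbit_pattern G1 v \<circ> inv h)"
proof -
  have "w $ h i \<in> orbit G1 (v $ i) \<longleftrightarrow> orbit_pattern G1 w (h i) = orbit_pattern G1 v i"
    for h i
    unfolding orbit_pattern_def using orbit_eq_iff[OF G1] by blast
  then show ?thesis
    unfolding orbit_wreath_iff[OF G1 H]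
    using bij_fun_eq_comp_inv[OF perm_group_bij[OF H]] by metis
qed

text \<open>The orbit counting formula
  |orbit_W(v)| = |H-orbit of the pattern Q of v| * prod_i |Q_i|.\<close>
lemma card_orbit_wreath:
  fixes G1 :: "('v::finite \<Rightarrow> 'v) set" and H :: "('n::finite \<Rightarrow> 'n) set"
  assumes G1: "perm_group G1" and H: "perm_group H"
  shows "card (orbit (wreath G1 H) v) =
    card ((\<lambda>h. orbit_pattern G1 v \<circ> inv h) ` H) * (\<Prod>i\<in>UNIV. card (orbit G1 (v $ i)))"
proof -
  let ?X = "orbit (wreath G1 H) v" and ?Q = "orbit_pattern G1 v"
  note member = orbit_wreath_pattern_iff[OF G1 H]
  have shifted_pattern: "orbit_pattern G1 (\<chi> j. v $ inv h j) = ?Q \<circ> inv h" for h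
    unfolding orbit_pattern_def by (simp add: fun_eq_iff)
  have patterns: "orbit_pattern G1 ` ?X = (\<lambda>h. ?Q \<circ> inv h) ` H"
  proof
    show "(\<lambda>h. ?Q \<circ> inv h) ` H \<subseteq> orbit_pattern G1 ` ?X"
      using member shifted_pattern by (metis (no_types, lifting) image_eqI image_subsetI)
  qed (use member in blast)
  have fibre: "card {w\<in>?X. orbit_pattern G1 w = B} = (\<Prod>i\<in>UNIV. card (?Q i))"
    if B: "B \<in> orbit_pattern G1 ` ?X" for B
  proof -
    obtain h where h: "h \<in> H" "B = ?Q \<circ> inv h" using B patterns by auto
    have "orbit_pattern G1 w = B \<longleftrightarrow> (\<forall>j. w $ j \<in> B j)" for w
      unfolding h(2) orbit_pattern_def using orbit_eq_iff[OF G1] by (simp add: fun_eq_iff)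
    then have "{w\<in>?X. orbit_pattern G1 w = B} = {w. \<forall>j. w $ j \<in> B j}"
      using member h by blast
    then have "card {w\<in>?X. orbit_pattern G1 w = B} = (\<Prod>j\<in>UNIV. card (?Q (inv h j)))"
      by (simp add: card_vec_product h(2))
    also have "\<dots> = (\<Prod>i\<in>UNIV. card (?Q i))"
      by (rule prod.reindex_bij_betw) (use perm_group_bij[OF H h(1)] bij_imp_bij_inv in auto)
    finally show ?thesis .
  qed
  show ?thesis
    using card_by_fibres[of ?X "orbit_pattern G1", OF _ fibre] patterns
    by (simp add: orbit_pattern_def)
qed

text \<open>The H-orbit of a pattern has size dividing |H|.\<close>
lemma card_pattern_orbit_dvd:
  fixes H :: "('n::finite \<Rightarrow> 'n) set" and Q :: "'n \<Rightarrow> 'a"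
  assumes H: "perm_group H"
  shows "card ((\<lambda>h. Q \<circ> inv h) ` H) dvd card H"
proof (rule card_orbit_dvd_card[OF H, of "\<lambda>h P. P \<circ> inv h"])
  show "finite H" by (rule finite_subset[OF subset_UNIV]) simp
  show "P \<circ> inv (g \<circ> h) = P \<circ> inv h \<circ> inv g"
    if "g \<in> H" "h \<in> H" for g h and P :: "'n \<Rightarrow> 'a"
    using that perm_group_bij[OF H] by (simp add: o_inv_distrib o_assoc)
qed (simp add: inv_id)

subsection \<open>The two cases\<close>

text \<open>A linear group transitive on the nonzero vectors has exactly the orbits
  {0} and V1 - {0}.\<close>
lemma orbit_transitive_nonzero:
  fixes G1 :: "('f::field ^ 'k \<Rightarrow> 'f ^ 'k) set"
  assumes G1: "linear_group (*s) G1" and tr: "transitive_nonzero G1"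
  shows "orbit G1 u = (if u = 0 then {0} else UNIV - {0})"
proof -
  have zero: "g x = 0 \<longleftrightarrow> x = 0" if "g \<in> G1" for g x
  proof -
    have lin: "Vector_Spaces.linear (*s) (*s) g" and "bij g"
      using that G1 unfolding linear_group_def GL_def by auto
    have "g (0 *s 0) = 0 *s g 0"
      using lin[unfolded Vector_Spaces.linear_iff] by blast
    then have "g 0 = 0" by simp
    then show ?thesis using \<open>bij g\<close> by (metis bij_is_inj injD)
  qed
  show ?thesis
  proof (cases "u = 0")
    case True
    have "G1 \<noteq> {}" using G1 unfolding linear_group_def perm_group_def by simp
    then show ?thesis using zero True unfolding orbit_def by (force simp: image_iff)
  next
    case False
    have "orbit G1 u \<subseteq> UNIV - {0}" using zero False unfolding orbit_def by auto
    moreover have "UNIV - {0} \<subseteq> orbit G1 u"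
      using tr False unfolding transitive_nonzero_def orbit_def by (auto simp: image_iff)
    ultimately show ?thesis using False by auto
  qed
qed

text \<open>Case (i): G1 transitive on the nonzero vectors and H p-concealed.  The
  pattern of v is the indicator pattern ind A of its support A, so the pattern
  orbit is in bijection with the H-orbit of A, and each coordinate orbit has size
  1 or p^k - 1.\<close>
lemma coprime_orbit_wreath_transitive:
  fixes G1 :: "('f::{field,finite} ^ 'k \<Rightarrow> 'f ^ 'k) set" and H :: "('n::finite \<Rightarrow> 'n) set"
  assumes G1: "linear_group (*s) G1" and H: "perm_group H" and tr: "transitive_nonzero G1"
    and concealed: "\<forall>A :: 'n set. coprime (card ((\<lambda>h. h ` A) ` H)) p"
    and p: "prime p" "CARD('f) = p"
  shows "coprime (card (orbit (wreath G1 H) v)) p"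
proof -
  have pG1: "perm_group G1" using G1 unfolding linear_group_def by simp
  define A where "A = {i. v $ i \<noteq> 0}"
  define ind where "ind B j = (if j \<in> B then UNIV - {0} else {0 :: 'f^'k})"
    for B :: "'n set" and j
  have pattern: "orbit_pattern G1 v = ind A"
    unfolding orbit_pattern_def ind_def A_def orbit_transitive_nonzero[OF G1 tr]
    by (auto simp: fun_eq_iff)
  have "ind A \<circ> inv h = ind (h ` A)" if "h \<in> H" for h
  proof -
    have "inv h j \<in> A \<longleftrightarrow> j \<in> h ` A" for j
      using perm_group_bij[OF H that] by (metis bij_inv_eq_iff image_iff)
    then show ?thesis unfolding ind_def by (simp add: fun_eq_iff)
  qed
  then have "(\<lambda>h. orbit_pattern G1 v \<circ> inv h) ` H = ind ` (\<lambda>h. h ` A) ` H"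
    unfolding pattern by force
  moreover have "inj ind" unfolding ind_def by (rule injI) (auto simp: fun_eq_iff split: if_splits)
  ultimately have pattern_orbit:
    "card ((\<lambda>h. orbit_pattern G1 v \<circ> inv h) ` H) = card ((\<lambda>h. h ` A) ` H)"
    by (simp add: card_image inj_on_subset)
  have "(\<Prod>i\<in>UNIV. card (orbit G1 (v $ i)))
      = (\<Prod>i\<in>UNIV. if i \<in> A then CARD('f^'k) - 1 else 1)"
    unfolding orbit_transitive_nonzero[OF G1 tr] A_def by (intro prod.cong) auto
  also have "\<dots> = (CARD('f^'k) - 1) ^ card A" by (simp add: prod.If_cases Int_absorb1)
  finally have coordinates:
    "(\<Prod>i\<in>UNIV. card (orbit G1 (v $ i))) = (p ^ CARD('k) - 1) ^ card A"
    using p(2) by simp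
  have "coprime (p ^ CARD('k) - 1) (p ^ CARD('k))"
    using prime_gt_0_nat[OF p(1)] by (intro coprime_diff_one_left_nat) simp
  then have "coprime (p ^ CARD('k) - 1) p" by simp
  then show ?thesis
    unfolding card_orbit_wreath[OF pG1 H] pattern_orbit coordinates using concealed by simp
qed

text \<open>Case (ii): every G1-orbit has size coprime to p and |H| is coprime to p.\<close>
lemma coprime_orbit_wreath_exceptional:
  fixes G1 :: "('v::finite \<Rightarrow> 'v) set" and H :: "('n::finite \<Rightarrow> 'n) set"
  assumes G1: "perm_group G1" and H: "perm_group H"
    and orbits: "\<forall>u. coprime (card (orbit G1 u)) p" and H_coprime: "coprime (card H) p"
  shows "coprime (card (orbit (wreath G1 H) v)) p"
proof -
  have "coprime (card ((\<lambda>h. orbit_pattern G1 v \<circ> inv h) ` H)) p"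
    using coprime_divisors[OF card_pattern_orbit_dvd[OF H] dvd_refl H_coprime] .
  moreover have "coprime (\<Prod>i\<in>UNIV. card (orbit G1 (v $ i))) p"
    using orbits by (simp add: prod_coprime_left)
  ultimately show ?thesis unfolding card_orbit_wreath[OF G1 H] by simp
qed

theorem lemma2p5:
  fixes p :: nat
    and G1 :: "('f::{field,finite} ^ 'k \<Rightarrow> 'f ^ 'k) set"
    and H :: "('n::finite \<Rightarrow> 'n) set"
  assumes "prime p"
    and "CARD('f) = p"
    and "linear_group (*s) G1"
    and "perm_group H"
    and "(transitive_nonzero G1 \<and> p_concealed p H) \<or>
         (p_exceptional (*s) p G1 \<and> coprime (card H) p)"
  shows "p_exceptional (block_scale :: 'f \<Rightarrow> _) p (wreath G1 H)"
proof -
  have pG1: "perm_group G1" using assms(3) unfolding linear_group_def by simp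
  have "(0::'f^'k) \<noteq> (\<chi> _. 1)" by (simp add: vec_eq_iff)
  then have card_W: "card (wreath G1 H) = card G1 ^ CARD('n) * card H"
    using card_wreath[OF pG1 assms(4)] by blast
  have "p dvd card (wreath G1 H) \<and> (\<forall>v. coprime (card (orbit (wreath G1 H) v)) p)"
    using assms(5)
  proof
    assume "transitive_nonzero G1 \<and> p_concealed p H"
    then show ?thesis
      using coprime_orbit_wreath_transitive[OF assms(3,4) _ _ assms(1,2)]
      unfolding card_W p_concealed_def by simp
  next
    assume exc: "p_exceptional (*s) p G1 \<and> coprime (card H) p"
    have "card G1 dvd card G1 ^ CARD('n)" by (rule dvd_power) simp
    then have "p dvd card G1 ^ CARD('n)"
      using exc unfolding p_exceptional_def by (blast intro: dvd_trans)
    then show ?thesis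
      using exc coprime_orbit_wreath_exceptional[OF pG1 assms(4)]
      unfolding card_W p_exceptional_def by simp
  qed
  then show ?thesis
    using linear_group_wreath[OF assms(3,4)] unfolding p_exceptional_def by simp
qed

end
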